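(* Let $n\ge 2$, $d=2^{\lfloor n/2\rfloor}$, and let $\gamma_1,\dots,\gamma_n\in M_d(\mathbb C)$ satisfy $\gamma_i^\dagger=\gamma_i$, $\gamma_i^2=I$, and $\gamma_i\gamma_j=-\gamma_j\gamma_i$ for $i\neq j$. For $i<j$ put $S_{ij}=\tfrac12\gamma_i\gamma_j$ and let $\mathfrak{spin}(n)$ be the real span of $\{S_{ij}:1\le i<j\le n\}$. Then $S_{ij}^\dagger=-S_{ij}$ and $\langle S_{ij},S_{kl}\rangle=\tfrac d4\,\delta_{ik}\delta_{jl}$ for all $i<j$ and $k<l$; consequently the matrices $B_{ij}=\tfrac{2}{\sqrt d}S_{ij}$ ($i<j$) form an orthonormal basis of $\mathfrak{spin}(n)$, and for every $l_0\in M_d(\mathbb C)$ the orthogonal projection of $l_0$ onto $\mathfrak{spin}(n)$ is $$\mathrm{proj}_{\mathfrak{spin}(n)}(l_0)=\sum_{i<j}\langle B_{ij},l_0\rangle\,B_{ij}.$$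
   Context: $\langle A,B\rangle=\mathrm{Re}\,\mathrm{tr}(A^\dagger B)$ is the real Frobenius inner product on $M_d(\mathbb C)$ viewed as a real vector space, and orthogonality, orthonormality and orthogonal projection are with respect to it; $A^\dagger$ is the conjugate transpose and $\delta$ is the Kronecker delta. The orthogonal projection of $l_0$ onto a real subspace $\mathfrak g$ is the element $P\in\mathfrak g$ with $\langle l_0-P,Y\rangle=0$ for all $Y\in\mathfrak g$. *)

theory Defs
  imports "HOL-Analysis.Analysis"
begin

definition dagger :: "complex^'d^'d \<Rightarrow> complex^'d^'d" where
  "dagger A = (\<chi> i j. cnj (A $ j $ i))"

definition frob :: "complex^'d^'d \<Rightarrow> complex^'d^'d \<Rightarrow> real" where
  "frob A B = Re (trace (dagger A ** B))"

definition frob_orthonormal_basis ::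
    "'i set \<Rightarrow> ('i \<Rightarrow> complex^'d^'d) \<Rightarrow> (complex^'d^'d) set \<Rightarrow> bool" where
  "frob_orthonormal_basis I b V \<longleftrightarrow>
     (\<forall>p\<in>I. \<forall>q\<in>I. frob (b p) (b q) = of_bool (p = q)) \<and>
     inj_on b I \<and> independent (b ` I) \<and> span (b ` I) = V"

definition is_frob_proj ::
    "(complex^'d^'d) set \<Rightarrow> complex^'d^'d \<Rightarrow> complex^'d^'d \<Rightarrow> bool" where
  "is_frob_proj V l P \<longleftrightarrow> P \<in> V \<and> (\<forall>Y\<in>V. frob (l - P) Y = 0)"

definition frob_proj ::
    "(complex^'d^'d) set \<Rightarrow> complex^'d^'d \<Rightarrow> complex^'d^'d" where
  "frob_proj V l = (THE P. is_frob_proj V l P)"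

(* Only the values of g on {1..n} are relevant. *)
definition gamma_system :: "nat \<Rightarrow> (nat \<Rightarrow> complex^'d^'d) \<Rightarrow> bool" where
  "gamma_system n g \<longleftrightarrow>
     (\<forall>i\<in>{1..n}. dagger (g i) = g i) \<and>
     (\<forall>i\<in>{1..n}. g i ** g i = mat 1) \<and>
     (\<forall>i\<in>{1..n}. \<forall>j\<in>{1..n}. i \<noteq> j \<longrightarrow> g i ** g j = - (g j ** g i))"

definition index_pairs :: "nat \<Rightarrow> (nat \<times> nat) set" where
  "index_pairs n = {(i, j). 1 \<le> i \<and> i < j \<and> j \<le> n}"

definition spin_S :: "(nat \<Rightarrow> complex^'d^'d) \<Rightarrow> nat \<Rightarrow> nat \<Rightarrow> complex^'d^'d" where
  "spin_S g i j = (1 / 2) *\<^sub>R (g i ** g j)"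

(* span is over the reals: complex^'d^'d carries its real_vector structure. *)
definition spin_algebra :: "nat \<Rightarrow> (nat \<Rightarrow> complex^'d^'d) \<Rightarrow> (complex^'d^'d) set" where
  "spin_algebra n g = span {spin_S g i j | i j. (i, j) \<in> index_pairs n}"

definition spin_B :: "(nat \<Rightarrow> complex^'d^'d) \<Rightarrow> nat \<Rightarrow> nat \<Rightarrow> complex^'d^'d" where
  "spin_B g i j = (2 / sqrt (real CARD('d))) *\<^sub>R spin_S g i j"

end

theory Submission
  imports Defs
begin

text \<open>
  The Frobenius form is the Euclidean inner product of \<open>complex^'d^'d\<close>, so once the bivectors
  \<open>S\<^sub>i\<^sub>j\<close> are known to be orthogonal of norm \<open>\<surd>d / 2\<close>, the basis and projection claims are the usual
  facts about an orthonormal family (\<open>frob_orthonormal_basisI\<close>, \<open>is_frob_proj_expansion\<close>,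
  \<open>is_frob_proj_unique\<close>).

  Orthogonality comes from one observation: a matrix that anticommutes with an involution \<open>U\<close> is
  similar to its own negative, hence traceless (\<open>trace_eq_0_if_anticommutes\<close>). Moving \<open>\<gamma>\<^sub>a\<close> past a
  bivector \<open>\<gamma>\<^sub>i \<gamma>\<^sub>j\<close> costs a sign exactly when \<open>a \<in> {i, j}\<close>. If two index pairs differ, some index of
  the first does not occur in the second; the corresponding \<open>\<gamma>\<close> anticommutes with the product of
  the two bivectors, so that product has trace zero (\<open>trace_bivectors_eq_0\<close>). For equal pairs the
  product reduces to the identity, of trace \<open>d\<close>.
\<close>

section \<open>The Frobenius form as a Euclidean inner product\<close>

lemma frob_eq_inner: "frob A B = A \<bullet> B"
proof -
  have "frob A B = (\<Sum>j\<in>UNIV. \<Sum>i\<in>UNIV. A $ i $ j \<bullet> B $ i $ j)"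
    by (simp add: frob_def dagger_def trace_def matrix_matrix_mult_def Re_sum inner_complex_def)
  also have "\<dots> = A \<bullet> B"
    unfolding inner_vec_def by (rule sum.swap)
  finally show ?thesis .
qed

lemma frob_orthonormal_basisI:
  assumes ortho: "\<And>p q. p \<in> I \<Longrightarrow> q \<in> I \<Longrightarrow> b p \<bullet> b q = of_bool (p = q)"
    and "span (b ` I) = V"
  shows "frob_orthonormal_basis I b V"
proof -
  have "inj_on b I"
    by (metis (mono_tags, lifting) inj_onI ortho of_bool_eq_iff)
  moreover have "independent (b ` I)"
  proof (rule pairwise_orthogonal_independent)
    show "pairwise orthogonal (b ` I)"
      using ortho by (force simp: pairwise_def orthogonal_def)
    show "0 \<notin> b ` I"
      using ortho by force
  qed
  ultimately show ?thesis
    using assms by (simp add: frob_orthonormal_basis_def frob_eq_inner)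
qed

lemma is_frob_proj_expansion:
  assumes "finite I" "frob_orthonormal_basis I b V"
  shows "is_frob_proj V l (\<Sum>p\<in>I. frob (b p) l *\<^sub>R b p)"
proof -
  let ?P = "\<Sum>p\<in>I. frob (b p) l *\<^sub>R b p"
  have ortho: "b p \<bullet> b q = of_bool (p = q)" if "p \<in> I" "q \<in> I" for p q
    using assms(2) that by (simp add: frob_orthonormal_basis_def frob_eq_inner)
  have V: "V = span (b ` I)"
    using assms(2) by (simp add: frob_orthonormal_basis_def)
  have "?P \<in> V"
    unfolding V by (intro span_sum span_scale span_base imageI)
  moreover have "frob (l - ?P) Y = 0" if "Y \<in> V" for Y
  proof -
    have "orthogonal (l - ?P) (b q)" if "q \<in> I" for q
    proof -
      have "?P \<bullet> b q = (\<Sum>p\<in>I. if p = q then b p \<bullet> l else 0)"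
        unfolding inner_sum_left
        by (rule sum.cong) (use that ortho in \<open>auto simp: frob_eq_inner\<close>)
      also have "\<dots> = b q \<bullet> l"
        using assms(1) that by simp
      finally show ?thesis
        by (simp add: orthogonal_def inner_diff_left inner_commute[of l])
    qed
    then show ?thesis
      using orthogonal_to_span[of Y "b ` I" "l - ?P"] that
      by (auto simp: V frob_eq_inner orthogonal_def)
  qed
  ultimately show ?thesis
    by (simp add: is_frob_proj_def)
qed

lemma is_frob_proj_unique:
  assumes "subspace V" "is_frob_proj V l P" "is_frob_proj V l Q"
  shows "P = Q"
proof -
  have mem: "P - Q \<in> V"
    using assms by (simp add: is_frob_proj_def subspace_diff)
  have "(P - Q) \<bullet> (P - Q) = (l - Q) \<bullet> (P - Q) - (l - P) \<bullet> (P - Q)"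
    by (simp flip: inner_diff_left)
  also have "\<dots> = 0"
    using assms mem by (simp add: is_frob_proj_def frob_eq_inner)
  finally show ?thesis
    by simp
qed

section \<open>Traces of products of gamma matrices\<close>

lemma matrix_mult_minus_left: "(- A) ** B = - (A ** B)" for A B :: "'a::ring_1^'n^'n"
  by (simp add: matrix_matrix_mult_def vec_eq_iff sum_negf)

lemma matrix_mult_minus_right: "A ** (- B) = - (A ** B)" for A B :: "'a::ring_1^'n^'n"
  by (simp add: matrix_matrix_mult_def vec_eq_iff sum_negf)

lemma dagger_mult: "dagger (A ** B) = dagger B ** dagger A"
  by (simp add: dagger_def matrix_matrix_mult_def vec_eq_iff mult.commute)

lemma dagger_scaleR: "dagger (c *\<^sub>R A) = c *\<^sub>R dagger A"
  by (simp add: dagger_def vec_eq_iff)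

text \<open>Conjugation by the involution preserves the trace but sends \<open>X\<close> to \<open>- X\<close>.\<close>

lemma trace_eq_0_if_anticommutes:
  fixes U X :: "complex^'d^'d"
  assumes "U ** U = mat 1" "U ** X = - (X ** U)"
  shows "trace X = 0"
proof -
  have "trace X = trace (U ** (U ** X))"
    by (simp add: matrix_mul_assoc assms(1))
  also have "\<dots> = trace ((U ** X) ** U)"
    by (rule trace_mul_sym)
  also have "\<dots> = - trace (X ** (U ** U))"
    by (simp add: assms(2) matrix_mult_minus_left matrix_mul_assoc trace_def sum_negf)
  finally show ?thesis
    by (simp add: assms(1))
qed

lemma
  assumes "gamma_system n g" "i \<in> {1..n}"
  shows gamma_selfadjoint: "dagger (g i) = g i"
    and gamma_involution: "g i ** g i = mat 1"
  using assms unfolding gamma_system_def by blast+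

lemma gamma_anticommute:
  assumes "gamma_system n g" "i \<in> {1..n}" "j \<in> {1..n}" "i \<noteq> j"
  shows "g i ** g j = - (g j ** g i)"
  using assms unfolding gamma_system_def by blast

lemma gamma_commutes_bivector:
  assumes "gamma_system n g" "a \<in> {1..n}" "i \<in> {1..n}" "j \<in> {1..n}" "a \<noteq> i" "a \<noteq> j"
  shows "g a ** (g i ** g j) = (g i ** g j) ** g a"
proof -
  have i: "g a ** g i = - (g i ** g a)" and j: "g a ** g j = - (g j ** g a)"
    using assms by (auto intro: gamma_anticommute)
  have "g a ** (g i ** g j) = - (g i ** (g a ** g j))"
    by (simp add: matrix_mul_assoc i matrix_mult_minus_left)
  then show ?thesis
    by (simp add: j matrix_mult_minus_right matrix_mul_assoc)
qed

lemma gamma_anticommutes_bivector: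
  assumes "gamma_system n g" "i \<in> {1..n}" "j \<in> {1..n}" "i \<noteq> j" "a = i \<or> a = j"
  shows "g a ** (g i ** g j) = - ((g i ** g j) ** g a)"
proof -
  have anti: "g i ** g j = - (g j ** g i)"
    using assms by (auto intro: gamma_anticommute)
  have "g i ** (g i ** g j) = - ((g i ** g j) ** g i)"
    by (subst anti) (simp add: matrix_mul_assoc matrix_mult_minus_right)
  moreover have "g j ** (g i ** g j) = - ((g i ** g j) ** g j)"
    by (subst (2) anti) (simp add: matrix_mul_assoc matrix_mult_minus_left)
  ultimately show ?thesis
    using assms(5) by auto
qed

lemma trace_bivectors_eq_0:
  assumes "gamma_system n g" "(i, j) \<in> index_pairs n" "(k, l) \<in> index_pairs n" "(i, j) \<noteq> (k, l)"
  shows "trace ((g i ** g j) ** (g k ** g l)) = 0"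
proof -
  have range: "i \<in> {1..n}" "j \<in> {1..n}" "k \<in> {1..n}" "l \<in> {1..n}" "i < j" "k < l"
    using assms(2,3) by (auto simp: index_pairs_def)
  \<comment> \<open>As both pairs are increasing, \<open>{i, j} \<subseteq> {k, l}\<close> would force them to coincide.\<close>
  obtain a where a: "a = i \<or> a = j" "a \<noteq> k" "a \<noteq> l"
    using range(5,6) assms(4) by (metis less_asym' less_irrefl)
  then have a_range: "a \<in> {1..n}"
    using range by auto
  have "g a ** ((g i ** g j) ** (g k ** g l)) = - ((g i ** g j) ** (g a ** (g k ** g l)))"
    using gamma_anticommutes_bivector[OF assms(1) range(1,2) _ a(1)] range(5)
    by (simp add: matrix_mul_assoc matrix_mult_minus_left)
  also have "\<dots> = - (((g i ** g j) ** (g k ** g l)) ** g a)"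
    using gamma_commutes_bivector[OF assms(1) a_range range(3,4) a(2,3)]
    by (simp add: matrix_mul_assoc)
  finally show ?thesis
    using gamma_involution[OF assms(1) a_range] by (intro trace_eq_0_if_anticommutes[of "g a"])
qed

section \<open>The spin algebra\<close>

lemma dagger_spin_S:
  assumes "gamma_system n g" "(i, j) \<in> index_pairs n"
  shows "dagger (spin_S g i j) = - spin_S g i j"
proof -
  have "dagger (g i) = g i" "dagger (g j) = g j" "g j ** g i = - (g i ** g j)"
    using assms
    by (auto simp: index_pairs_def intro: gamma_selfadjoint[of n] gamma_anticommute[of n])
  then show ?thesis
    by (simp add: spin_S_def dagger_scaleR dagger_mult)
qed

lemma frob_spin_S:
  fixes g :: "nat \<Rightarrow> complex^'d^'d"
  assumes "gamma_system n g" "(i, j) \<in> index_pairs n" "(k, l) \<in> index_pairs n"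
  shows "frob (spin_S g i j) (spin_S g k l) = real CARD('d) / 4 * of_bool ((i, j) = (k, l))"
proof -
  have "frob (spin_S g i j) (spin_S g k l) = 1 / 4 * frob (g i ** g j) (g k ** g l)"
    by (simp add: spin_S_def frob_eq_inner)
  moreover have "frob (g i ** g j) (g k ** g l) = real CARD('d) * of_bool ((i, j) = (k, l))"
  proof (cases "(i, j) = (k, l)")
    case True
    have *: "dagger (g i) = g i" "dagger (g j) = g j"
      "g i ** g i = mat 1" "g j ** g j = mat 1"
      using assms
      by (auto simp: index_pairs_def intro: gamma_selfadjoint[of n] gamma_involution[of n])
    have "dagger (g i ** g j) ** (g i ** g j) = g j ** (g i ** g i) ** g j"
      by (simp add: dagger_mult *(1,2) matrix_mul_assoc)
    also have "\<dots> = mat 1"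
      by (simp add: *)
    finally show ?thesis
      using True by (simp add: frob_def trace_def mat_def)
  next
    case False
    have "dagger (g i ** g j) = - (g i ** g j)"
      using dagger_spin_S[OF assms(1,2)]
      by (simp add: spin_S_def dagger_scaleR flip: scaleR_minus_right)
    then have "trace (dagger (g i ** g j) ** (g k ** g l)) = - trace ((g i ** g j) ** (g k ** g l))"
      by (simp add: matrix_mult_minus_left trace_def sum_negf)
    also have "\<dots> = 0"
      using trace_bivectors_eq_0[OF assms False] by simp
    finally show ?thesis
      using False by (simp add: frob_def)
  qed
  ultimately show ?thesis
    by simp
qed

lemma span_image_scaleR:
  fixes f :: "'i \<Rightarrow> 'a::real_vector"
  assumes "c \<noteq> 0"
  shows "span ((\<lambda>p. c *\<^sub>R f p) ` I) = span (f ` I)"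
proof (rule span_eq[THEN iffD2], intro conjI image_subsetI)
  fix p assume "p \<in> I"
  then show "c *\<^sub>R f p \<in> span (f ` I)"
    by (intro span_scale span_base imageI)
  have "f p = (1 / c) *\<^sub>R (c *\<^sub>R f p)"
    using assms by simp
  also have "\<dots> \<in> span ((\<lambda>p. c *\<^sub>R f p) ` I)"
    using \<open>p \<in> I\<close> by (intro span_scale span_base imageI)
  finally show "f p \<in> span ((\<lambda>p. c *\<^sub>R f p) ` I)" .
qed

lemma spin_B_orthonormal_basis:
  fixes g :: "nat \<Rightarrow> complex^'d^'d"
  assumes "gamma_system n g"
  shows "frob_orthonormal_basis (index_pairs n) (\<lambda>(i, j). spin_B g i j) (spin_algebra n g)"
proof (rule frob_orthonormal_basisI)
  fix p q assume "p \<in> index_pairs n" "q \<in> index_pairs n"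
  moreover obtain i j k l where "p = (i, j)" "q = (k, l)"
    by fastforce
  ultimately show "(case p of (i, j) \<Rightarrow> spin_B g i j) \<bullet> (case q of (i, j) \<Rightarrow> spin_B g i j)
      = of_bool (p = q)"
    using frob_spin_S[OF assms, of i j k l]
    by (auto simp: spin_B_def frob_eq_inner)
next
  let ?S = "\<lambda>p. spin_S g (fst p) (snd p)"
  let ?c = "2 / sqrt (real CARD('d))"
  have "span ((\<lambda>(i, j). spin_B g i j) ` index_pairs n)
      = span ((\<lambda>p. ?c *\<^sub>R ?S p) ` index_pairs n)"
    by (simp add: spin_B_def case_prod_beta)
  also have "\<dots> = span (?S ` index_pairs n)"
    by (rule span_image_scaleR) simp
  also have "?S ` index_pairs n = {spin_S g i j | i j. (i, j) \<in> index_pairs n}"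
    by force
  finally show "span ((\<lambda>(i, j). spin_B g i j) ` index_pairs n) = spin_algebra n g"
    by (simp add: spin_algebra_def)
qed

lemma finite_index_pairs: "finite (index_pairs n)"
  by (rule finite_subset[of _ "{1..n} \<times> {1..n}"]) (auto simp: index_pairs_def)

theorem mainTheorem7:
  fixes n d :: nat and \<gamma> :: "nat \<Rightarrow> complex^'d^'d"
  assumes "n \<ge> 2"
    and "d = 2 ^ (n div 2)"
    and "CARD('d) = d"
    and "gamma_system n \<gamma>"
  shows "(\<forall>(i, j)\<in>index_pairs n. dagger (spin_S \<gamma> i j) = - spin_S \<gamma> i j)
    \<and> (\<forall>(i, j)\<in>index_pairs n. \<forall>(k, l)\<in>index_pairs n.
          frob (spin_S \<gamma> i j) (spin_S \<gamma> k l) = real d / 4 * of_bool (i = k) * of_bool (j = l))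
    \<and> frob_orthonormal_basis (index_pairs n) (\<lambda>(i, j). spin_B \<gamma> i j) (spin_algebra n \<gamma>)
    \<and> (\<forall>l0. is_frob_proj (spin_algebra n \<gamma>) l0
              (\<Sum>(i, j)\<in>index_pairs n. frob (spin_B \<gamma> i j) l0 *\<^sub>R spin_B \<gamma> i j)
          \<and> frob_proj (spin_algebra n \<gamma>) l0
              = (\<Sum>(i, j)\<in>index_pairs n. frob (spin_B \<gamma> i j) l0 *\<^sub>R spin_B \<gamma> i j))"
proof -
  have basis: "frob_orthonormal_basis (index_pairs n) (\<lambda>(i, j). spin_B \<gamma> i j) (spin_algebra n \<gamma>)"
    using assms(4) by (rule spin_B_orthonormal_basis)
  have proj: "is_frob_proj (spin_algebra n \<gamma>) l0
      (\<Sum>(i, j)\<in>index_pairs n. frob (spin_B \<gamma> i j) l0 *\<^sub>R spin_B \<gamma> i j)" for l0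
    using is_frob_proj_expansion[OF finite_index_pairs basis, of l0]
    by (simp add: case_prod_beta)
  have "subspace (spin_algebra n \<gamma>)"
    by (simp add: spin_algebra_def)
  then have "frob_proj (spin_algebra n \<gamma>) l0
      = (\<Sum>(i, j)\<in>index_pairs n. frob (spin_B \<gamma> i j) l0 *\<^sub>R spin_B \<gamma> i j)" for l0
    unfolding frob_proj_def using proj is_frob_proj_unique by (intro the_equality) blast+
  moreover have "\<forall>(i, j)\<in>index_pairs n. dagger (spin_S \<gamma> i j) = - spin_S \<gamma> i j"
    using dagger_spin_S[OF assms(4)] by blast
  moreover have "\<forall>(i, j)\<in>index_pairs n. \<forall>(k, l)\<in>index_pairs n.
      frob (spin_S \<gamma> i j) (spin_S \<gamma> k l) = real d / 4 * of_bool (i = k) * of_bool (j = l)"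
    using frob_spin_S[OF assms(4)] assms(3) by (simp add: case_prod_beta)
  ultimately show ?thesis
    using basis proj by blast
qed

end
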